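(* Let the roundoffs $\delta_1,\ldots,\delta_{2n}$ in shifted general summation of $x_1,\ldots,x_n$ with shift $c$ be mean-independent mean-zero random variables with $|\delta_k|\le u$, i.e. $\mathbb{E}(\delta_k\mid\delta_1,\ldots,\delta_{k-1})=\mathbb{E}(\delta_k)=0$ for all $k$. Let $h$ be the height of the computational tree in the inner call to general summation, and $\lambda\equiv\sqrt{2\ln(2(2n+1)/\eta)}$. For any $\eta>0$ with $\lambda\sqrt{h+2}\,u<1$ and any $\delta\in(0,1)$, with probability at least $1-(\delta+\eta)$, the error in shifted general summation is bounded by $$|\hat{s}_n-s_n|\le\frac{u}{1-\lambda\sqrt{h+2}\,u}\left(s_n^2+\sum_{k=2}^n t_k^2+\sum_{k=1}^n y_k^2\right)^{1/2}\sqrt{2\ln(2/\delta)}.$$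
   Context: General summation of real numbers $y_1,\ldots,y_n$ ($n\ge 2$): start with the multiset $\mathcal{S}=\{y_1,\ldots,y_n\}$; for $k=2,\ldots,n$ remove two elements $a,b$ from $\mathcal{S}$, set $t_k=a+b$, and add $t_k$ to $\mathcal{S}$; the output is $t_n=\sum_i y_i$. The order of summation is fixed in advance. Its computational tree is the binary tree with leaves $y_1,\ldots,y_n$ and internal vertices $t_2,\ldots,t_n$ (root $t_n$), the children of $t_k$ being the two elements $a,b$ with $t_k=a+b$; the height $h$ is the length of the longest downward path from the root to a leaf. Shifted general summation of real numbers $x_1,\ldots,x_n$ with shift $c$: compute $y_k=x_k-c$ for $1\le k\le n$; compute $t_n$ by general summation applied to $y_1,\ldots,y_n$ (inner call), with exact partial sums $t_2,\ldots,t_n$; return $s_n=t_n+nc=\sum_k x_k$. This is regarded as a general summation of the $2n+1$ inputs $x_1,-c,x_2,-c,\ldots,x_n,-c,nc$, all stored exactly (in particular $nc$ is an exact input), with a tree of height $h+2$. Floating point model (unit roundoff $0<u<1$, no overflow or underflow): each of the $2n$ additions (the $n$ shifts $y_k=x_k+(-c)$, the $n-1$ sums $t_k$, and the final sum $t_n+nc$) is performed on the computed operands and the result is multiplied by $1+\delta_i$ with $|\delta_i|\le u$. The roundoffs are numbered $\delta_1,\ldots,\delta_{2n}$ in the order in which they are generated: $\hat{y}_k=(x_k-c)(1+\delta_k)$ for $1\le k\le n$, $\hat{t}_k=(\hat{a}+\hat{b})(1+\delta_{n+k-1})$ for $2\le k\le n$ (where $\hat a,\hat b$ are the computed values of the children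 of $t_k$), and $\hat{s}_n=(\hat{t}_n+nc)(1+\delta_{2n})$. The $x_k$ and $c$ are deterministic; $y_k,t_k,s_n$ without hats are exact values. *)

theory Defs
  imports "HOL-Probability.Probability"
begin

text \<open>
  Vertices of the computational tree of general summation of \<open>n\<close> numbers:
  \<open>Leaf i\<close> (\<open>1 \<le> i \<le> n\<close>) is the \<open>i\<close>-th input and \<open>Inner k\<close> (\<open>2 \<le> k \<le> n\<close>) is the
  partial sum \<open>t\<^sub>k\<close>.  The order of summation, fixed in advance, is a function
  \<open>ch\<close> that gives the two children of \<open>t\<^sub>k\<close>; only its values on \<open>{2..n}\<close> matter.
\<close>

datatype vertex = Leaf nat | Inner nat

text \<open>
  \<open>pool n ch k\<close> is the multiset \<open>S\<close> after \<open>t\<^sub>k\<close> has been added (the initial one for \<open>k = 1\<close>).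
  It is kept as a set of vertices, so that equal numerical values remain distinct elements.
\<close>

fun pool :: "nat \<Rightarrow> (nat \<Rightarrow> vertex \<times> vertex) \<Rightarrow> nat \<Rightarrow> vertex set" where
  "pool n ch k =
     (if k < 2 then Leaf ` {1..n}
      else insert (Inner k) (pool n ch (k - 1) - {fst (ch k), snd (ch k)}))"

declare pool.simps [simp del]

definition summation_order :: "nat \<Rightarrow> (nat \<Rightarrow> vertex \<times> vertex) \<Rightarrow> bool" where
  "summation_order n ch \<longleftrightarrow>
     (\<forall>k\<in>{2..n}. fst (ch k) \<in> pool n ch (k - 1) \<and> snd (ch k) \<in> pool n ch (k - 1) \<and>
        fst (ch k) \<noteq> snd (ch k))"

definition is_child :: "(nat \<Rightarrow> vertex \<times> vertex) \<Rightarrow> vertex \<Rightarrow> vertex \<Rightarrow> bool" where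
  "is_child ch v w \<longleftrightarrow> (\<exists>k. v = Inner k \<and> (w = fst (ch k) \<or> w = snd (ch k)))"

text \<open>A path is the list of its vertices, so it has one edge fewer than its length.\<close>

definition root_leaf_path :: "nat \<Rightarrow> (nat \<Rightarrow> vertex \<times> vertex) \<Rightarrow> vertex list \<Rightarrow> bool" where
  "root_leaf_path n ch p \<longleftrightarrow>
     p \<noteq> [] \<and> hd p = Inner n \<and> last p \<in> range Leaf \<and> successively (is_child ch) p"

definition tree_height :: "nat \<Rightarrow> (nat \<Rightarrow> vertex \<times> vertex) \<Rightarrow> nat" where
  "tree_height n ch = Max {length p - 1 | p. root_leaf_path n ch p}"

fun stage :: "vertex \<Rightarrow> nat" where
  "stage (Leaf i) = 0"
| "stage (Inner k) = Suc k"

text \<open>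
  Value at a vertex for inputs \<open>y\<close>, where the sum \<open>t\<^sub>k\<close> commits the relative error \<open>e k\<close>.
  The conditional only serves termination: in a summation order (and \<open>k \<in> {2..n}\<close>)
  both children are formed before \<open>t\<^sub>k\<close>, so the else branch is not taken.
\<close>

function vertex_val ::
  "(nat \<Rightarrow> vertex \<times> vertex) \<Rightarrow> (nat \<Rightarrow> real) \<Rightarrow> (nat \<Rightarrow> real) \<Rightarrow> vertex \<Rightarrow> real" where
  "vertex_val ch y e (Leaf i) = y i"
| "vertex_val ch y e (Inner k) =
     (if stage (fst (ch k)) < stage (Inner k) \<and> stage (snd (ch k)) < stage (Inner k)
      then (vertex_val ch y e (fst (ch k)) + vertex_val ch y e (snd (ch k))) * (1 + e k)
      else 0)"
  by pat_completeness auto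
termination
  by (relation "Wellfounded.measure (\<lambda>(ch, y, e, v). stage v)") auto

declare vertex_val.simps(2) [simp del]

definition exact_y :: "(nat \<Rightarrow> real) \<Rightarrow> real \<Rightarrow> nat \<Rightarrow> real" where
  "exact_y x c k = x k - c"

definition exact_t ::
  "(nat \<Rightarrow> vertex \<times> vertex) \<Rightarrow> (nat \<Rightarrow> real) \<Rightarrow> real \<Rightarrow> nat \<Rightarrow> real" where
  "exact_t ch x c k = vertex_val ch (exact_y x c) (\<lambda>_. 0) (Inner k)"

definition exact_s ::
  "nat \<Rightarrow> (nat \<Rightarrow> vertex \<times> vertex) \<Rightarrow> (nat \<Rightarrow> real) \<Rightarrow> real \<Rightarrow> real" where
  "exact_s n ch x c = exact_t ch x c n + real n * c"

text \<open>In the computed quantities, \<open>d\<close> lists the roundoffs \<open>d 1, \<dots>, d (2 * n)\<close>.\<close>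

definition computed_y :: "(nat \<Rightarrow> real) \<Rightarrow> real \<Rightarrow> (nat \<Rightarrow> real) \<Rightarrow> nat \<Rightarrow> real" where
  "computed_y x c d k = (x k - c) * (1 + d k)"

definition computed_t ::
  "nat \<Rightarrow> (nat \<Rightarrow> vertex \<times> vertex) \<Rightarrow> (nat \<Rightarrow> real) \<Rightarrow> real \<Rightarrow> (nat \<Rightarrow> real) \<Rightarrow> nat \<Rightarrow> real" where
  "computed_t n ch x c d k =
     vertex_val ch (computed_y x c d) (\<lambda>j. d (n + j - 1)) (Inner k)"

definition computed_s ::
  "nat \<Rightarrow> (nat \<Rightarrow> vertex \<times> vertex) \<Rightarrow> (nat \<Rightarrow> real) \<Rightarrow> real \<Rightarrow> (nat \<Rightarrow> real) \<Rightarrow> real" where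
  "computed_s n ch x c d = (computed_t n ch x c d n + real n * c) * (1 + d (2 * n))"

text \<open>
  The \<open>\<sigma>\<close>-algebra on \<open>space M\<close> generated by \<open>d 1, \<dots>, d (k - 1)\<close>, as the one
  generated by the random vector they form; it is trivial for \<open>k = 1\<close>.
\<close>

definition past_algebra :: "'a measure \<Rightarrow> (nat \<Rightarrow> 'a \<Rightarrow> real) \<Rightarrow> nat \<Rightarrow> 'a measure" where
  "past_algebra M d k =
     vimage_algebra (space M) (\<lambda>\<omega>. \<lambda>i\<in>{1..<k}. d i \<omega>) (PiM {1..<k} (\<lambda>_. borel))"

definition mean_independent_mean_zero ::
  "'a measure \<Rightarrow> nat \<Rightarrow> (nat \<Rightarrow> 'a \<Rightarrow> real) \<Rightarrow> bool" where
  "mean_independent_mean_zero M N d \<longleftrightarrow>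
     (\<forall>k\<in>{1..N}.
        (AE \<omega> in M. real_cond_exp M (past_algebra M d k) (d k) \<omega> = integral\<^sup>L M (d k)) \<and>
        integral\<^sup>L M (d k) = 0)"

end

theory Submission
  imports Defs
begin

text \<open>
  Write \<open>p\<^sub>v\<close> for the exact sum of the two computed operands of an addition \<open>v\<close> and \<open>s\<^sub>v\<close> for
  its exact value.  Unrolling the recursion of the errors gives, for every vertex, the error
  of the computed value as the sum of \<open>p\<^sub>w \<delta>\<^sub>w\<close> over all additions \<open>w\<close> in its subtree.  Since \<open>p\<^sub>w\<close>
  only depends on roundoffs that precede \<open>\<delta>\<^sub>w\<close>, this is a martingale, and one would like to apply
  the Azuma-Hoeffding inequality.  That needs deterministic bounds on the \<open>p\<^sub>w\<close>, whereas
  \<open>\<bar>p\<^sub>w\<bar> \<le> \<bar>s\<^sub>w\<bar> + \<bar>p\<^sub>w - s\<^sub>w\<bar>\<close> where the error \<open>p\<^sub>w - s\<^sub>w\<close> of the operands is random and itself a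
  martingale over the additions below \<open>w\<close>.

  The deterministic bounds come from a recursion up the tree: \<open>F\<^sub>v\<close> is \<open>\<lambda> u\<close> times the root of the sum
  of \<open>(\<bar>s\<^sub>w\<bar> + F\<^sub>w)\<^sup>2\<close> over the additions \<open>w\<close> below \<open>v\<close> (\<open>error_cap\<close>).  Replacing \<open>p\<^sub>w\<close> by \<open>0\<close> whenever
  \<open>\<bar>p\<^sub>w - s\<^sub>w\<bar>\<close> exceeds \<open>F\<^sub>w\<close> gives a weight (\<open>capped_sum\<close>) that still depends on the past only and is
  always at most \<open>\<bar>s\<^sub>w\<bar> + F\<^sub>w\<close>.  By \<open>weighted_roundoff_sum_tail\<close> and a union bound over the at most
  \<open>2n\<close> additions, all capped martingales below a vertex \<open>v\<close> stay within \<open>F\<^sub>v\<close> except with probability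
  \<open>\<eta>\<close>.  On that event, induction up the tree shows that the capping never happens
  (\<open>error_eq_capped_sums\<close>), so that the error at the root is the capped martingale.  One more use of
  the tail bound, with failure probability \<open>\<delta>\<close>, bounds it by
  \<open>u \<surd>Q \<surd>(2 ln (2/\<delta>))\<close>, where \<open>Q\<close> is the sum of all \<open>(\<bar>s\<^sub>w\<bar> + F\<^sub>w)\<^sup>2\<close> (\<open>energy\<close>).

  It remains to compare \<open>Q\<close> with the sum \<open>E\<close> of all \<open>s\<^sub>w\<^sup>2\<close>.  In the sum of all \<open>F\<^sub>v\<^sup>2\<close> each term of \<open>Q\<close>
  occurs once for every ancestor, hence at most \<open>H\<close> times in a tree of height \<open>H\<close>.  By Minkowski's
  inequality \<open>\<surd>Q \<le> \<surd>E + \<lambda> u \<surd>H \<surd>Q\<close>, which is solved for \<open>\<surd>Q\<close> (\<open>sqrt_energy_le\<close>).  Shifted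
  summation is the instance whose tree has height at most \<open>h + 2\<close>.
\<close>

section \<open>Azuma-Hoeffding bounds for past-dependent weights\<close>

text \<open>
  This is Hoeffding's lemma for a fair sign: \<open>ln (cosh y)\<close> is the function of
  \<open>Hoeffdings_lemma_aux\<close> at \<open>p = 1/2\<close> and step \<open>2y\<close>.
\<close>
lemma cosh_le_exp_half_square: "cosh x \<le> exp (x\<^sup>2 / 2)" for x :: real
proof -
  define y where "y = \<bar>x\<bar>"
  have "- (2 * y) * (1/2) + ln (1 + 1/2 * (exp (2 * y) - 1)) \<le> (2 * y)\<^sup>2 / 8"
    by (rule Hoeffdings_lemma_aux) (auto simp: y_def)
  moreover have "1 + 1/2 * (exp (2 * y) - 1) = exp y * cosh y"
    by (simp add: cosh_field_def exp_minus field_simps flip: exp_add)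
  ultimately have "ln (cosh y) \<le> y\<^sup>2 / 2"
    by (simp add: ln_mult)
  then have "cosh y \<le> exp (y\<^sup>2 / 2)"
    by (metis cosh_real_pos exp_le_cancel_iff exp_ln)
  then show ?thesis
    by (simp add: y_def)
qed

text \<open>
  On \<open>[-u, u]\<close> the convex function \<open>t \<mapsto> exp (s t)\<close> lies below its chord.  As the chord is affine
  in \<open>t\<close>, its conditional expectation for a mean-zero roundoff \<open>t\<close> is just \<open>cosh (s u)\<close>.
\<close>
lemma exp_le_cosh_chord:
  fixes s t u :: real
  assumes "\<bar>t\<bar> \<le> u" and "0 < u"
  shows "exp (s * t) \<le> cosh (s * u) + sinh (s * u) / u * t"
proof -
  define p where "p = (u - t) / (2 * u)"
  have p: "0 \<le> p" "p \<le> 1"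
    using assms by (auto simp: p_def field_simps)
  have "exp ((1 - p) *\<^sub>R (s * u) + p *\<^sub>R (- (s * u)))
          \<le> (1 - p) * exp (s * u) + p * exp (- (s * u))"
    by (rule convex_onD) (use p convex_on_exp[of 1] in auto)
  moreover have "(1 - p) *\<^sub>R (s * u) + p *\<^sub>R (- (s * u)) = s * t"
    using assms by (simp add: p_def field_simps)
  moreover have "(1 - p) * exp (s * u) + p * exp (- (s * u)) = cosh (s * u) + sinh (s * u) / u * t"
    using assms by (simp add: p_def cosh_field_def sinh_field_def field_simps)
  ultimately show ?thesis
    by simp
qed

locale mean_independent_roundoffs = prob_space M
  for M :: "'a measure" +
  fixes N :: nat and d :: "nat \<Rightarrow> 'a \<Rightarrow> real" and u :: real
  assumes roundoff_measurable: "k \<in> {1..N} \<Longrightarrow> d k \<in> borel_measurable M"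
    and roundoff_bound: "k \<in> {1..N} \<Longrightarrow> AE \<omega> in M. \<bar>d k \<omega>\<bar> \<le> u"
    and mean_independent: "mean_independent_mean_zero M N d"
    and u_pos: "0 < u"
begin

lemma space_past_algebra [simp]: "space (past_algebra M d k) = space M"
  by (simp add: past_algebra_def)

lemma past_roundoff_measurable:
  assumes "j \<in> {1..<k}"
  shows "d j \<in> borel_measurable (past_algebra M d k)"
proof -
  have "(\<lambda>\<omega>. \<lambda>i\<in>{1..<k}. d i \<omega>) \<in> past_algebra M d k \<rightarrow>\<^sub>M PiM {1..<k} (\<lambda>_. borel)"
    unfolding past_algebra_def by (rule measurable_vimage_algebra1) (auto simp: space_PiM)
  from measurable_compose[OF this measurable_component_singleton[OF assms]]
  show ?thesis
    using assms by simp
qed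

lemma sets_past_algebra_subset:
  assumes "space N' = space M" and "\<And>j. j \<in> {1..<k} \<Longrightarrow> d j \<in> borel_measurable N'"
  shows "sets (past_algebra M d k) \<subseteq> sets N'"
  unfolding past_algebra_def
  by (rule sets_image_in_sets[OF assms(1)]) (use assms(2) in measurable)

lemma past_algebra_mono:
  assumes "j \<le> k"
  shows "borel_measurable (past_algebra M d j) \<subseteq> borel_measurable (past_algebra M d k)"
proof (rule measurable_mono)
  show "sets (past_algebra M d j) \<le> sets (past_algebra M d k)"
    by (rule sets_past_algebra_subset) (use assms past_roundoff_measurable in auto)
qed auto

lemma subalgebra_past_algebra:
  assumes "k \<le> N + 1"
  shows "subalgebra M (past_algebra M d k)"
  unfolding subalgebra_def
  using sets_past_algebra_subset[of M k] roundoff_measurable assms by auto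

text \<open>
  The only way in which mean independence enters: a roundoff is orthogonal to every bounded
  function of the roundoffs before it.
\<close>
lemma expectation_past_times_roundoff:
  assumes k: "k \<in> {1..N}" and Z: "Z \<in> borel_measurable (past_algebra M d k)"
    and B: "AE \<omega> in M. \<bar>Z \<omega>\<bar> \<le> B"
  shows "integrable M (\<lambda>\<omega>. Z \<omega> * d k \<omega>)" and "expectation (\<lambda>\<omega>. Z \<omega> * d k \<omega>) = 0"
proof -
  have sub: "subalgebra M (past_algebra M d k)"
    using k by (intro subalgebra_past_algebra) auto
  interpret finite_measure_subalgebra M "past_algebra M d k"
    by unfold_locales (fact sub)
  have [measurable]: "Z \<in> borel_measurable M" "d k \<in> borel_measurable M"
    using measurable_from_subalg[OF sub Z] roundoff_measurable[OF k] by auto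
  show int: "integrable M (\<lambda>\<omega>. Z \<omega> * d k \<omega>)"
  proof (rule integrable_const_bound)
    show "AE \<omega> in M. norm (Z \<omega> * d k \<omega>) \<le> B * u"
      using B roundoff_bound[OF k]
      by eventually_elim (auto simp: abs_mult intro!: mult_mono)
  qed simp
  have "AE \<omega> in M. real_cond_exp M (past_algebra M d k) (d k) \<omega> = expectation (d k)"
    and "expectation (d k) = 0"
    using bspec[OF mean_independent[unfolded mean_independent_mean_zero_def] k] by blast+
  then have "AE \<omega> in M. real_cond_exp M (past_algebra M d k) (d k) \<omega> = 0"
    by simp
  then have "expectation (\<lambda>\<omega>. Z \<omega> * real_cond_exp M (past_algebra M d k) (d k) \<omega>) = 0"
    by (intro integral_eq_zero_AE) auto
  then show "expectation (\<lambda>\<omega>. Z \<omega> * d k \<omega>) = 0"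
    using real_cond_exp_intg(2)[OF int Z] by simp
qed

lemma weighted_roundoff_sum_AE_bound:
  fixes l :: "'b \<Rightarrow> nat"
  assumes "finite V" and "l ` V \<subseteq> {1..N}"
    and "\<And>v \<omega>. v \<in> V \<Longrightarrow> \<bar>g v \<omega>\<bar> \<le> c v"
  shows "AE \<omega> in M. \<bar>\<Sum>v\<in>V. g v \<omega> * d (l v) \<omega>\<bar> \<le> (\<Sum>v\<in>V. c v * u)"
proof -
  have "AE \<omega> in M. \<forall>v\<in>V. \<bar>d (l v) \<omega>\<bar> \<le> u"
    using assms roundoff_bound by (subst AE_finite_all) auto
  then show ?thesis
  proof eventually_elim
    case (elim \<omega>)
    have "\<bar>g v \<omega> * d (l v) \<omega>\<bar> \<le> c v * u" if "v \<in> V" for v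
      using assms(3)[OF that, of \<omega>] elim that by (auto simp: abs_mult intro!: mult_mono)
    then show ?case
      by (intro order.trans[OF sum_abs] sum_mono)
  qed
qed

text \<open>
  Every weight may depend on the past of its own roundoff.  The vertices are added in the order of
  their labels, so that everything accumulated so far and the new weight belong to the past of the
  new roundoff.  Bounding the new exponential factor by its chord then leaves a factor \<open>cosh\<close>,
  bounded by a constant, and a multiple of the new roundoff, whose expectation vanishes.
\<close>
lemma weighted_roundoff_sum_exp_moment:
  fixes l :: "'b \<Rightarrow> nat" and \<theta> :: real
  assumes "finite V" and "inj_on l V" and "l ` V \<subseteq> {1..N}"
    and "\<And>v. v \<in> V \<Longrightarrow> g v \<in> borel_measurable (past_algebra M d (l v))"
    and "\<And>v \<omega>. v \<in> V \<Longrightarrow> \<bar>g v \<omega>\<bar> \<le> c v"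
  shows "integrable M (\<lambda>\<omega>. exp (\<theta> * (\<Sum>v\<in>V. g v \<omega> * d (l v) \<omega>)))"
    and "expectation (\<lambda>\<omega>. exp (\<theta> * (\<Sum>v\<in>V. g v \<omega> * d (l v) \<omega>)))
           \<le> exp (\<theta>\<^sup>2 * u\<^sup>2 * (\<Sum>v\<in>V. (c v)\<^sup>2) / 2)"
proof -
  have past_sum: "(\<lambda>\<omega>. \<Sum>v\<in>S. g v \<omega> * d (l v) \<omega>) \<in> borel_measurable (past_algebra M d k)"
    if "S \<subseteq> V" "\<And>v. v \<in> S \<Longrightarrow> l v < k" for S k
  proof (rule borel_measurable_sum)
    fix v assume v: "v \<in> S"
    have "g v \<in> borel_measurable (past_algebra M d k)"
      using assms(4) past_algebra_mono[of "l v" k] that v by fastforce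
    moreover have "d (l v) \<in> borel_measurable (past_algebra M d k)"
      using that v assms(3) by (intro past_roundoff_measurable) force
    ultimately show "(\<lambda>\<omega>. g v \<omega> * d (l v) \<omega>) \<in> borel_measurable (past_algebra M d k)"
      by measurable
  qed
  have bounded: "AE \<omega> in M. \<bar>exp (\<theta> * (\<Sum>v\<in>S. g v \<omega> * d (l v) \<omega>))\<bar> \<le> exp (\<bar>\<theta>\<bar> * (\<Sum>v\<in>S. c v * u))"
    if "S \<subseteq> V" for S
  proof -
    have "AE \<omega> in M. \<bar>\<Sum>v\<in>S. g v \<omega> * d (l v) \<omega>\<bar> \<le> (\<Sum>v\<in>S. c v * u)"
      using that assms finite_subset by (intro weighted_roundoff_sum_AE_bound) auto
    then show ?thesis
    proof eventually_elim
      case (elim \<omega>)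
      have "\<theta> * (\<Sum>v\<in>S. g v \<omega> * d (l v) \<omega>) \<le> \<bar>\<theta>\<bar> * \<bar>\<Sum>v\<in>S. g v \<omega> * d (l v) \<omega>\<bar>"
        by (metis abs_ge_self abs_mult)
      also have "\<dots> \<le> \<bar>\<theta>\<bar> * (\<Sum>v\<in>S. c v * u)"
        using elim by (intro mult_left_mono) auto
      finally show ?case
        by simp
    qed
  qed
  have integrable: "integrable M (\<lambda>\<omega>. exp (\<theta> * (\<Sum>v\<in>S. g v \<omega> * d (l v) \<omega>)))" if "S \<subseteq> V" for S
  proof (rule integrable_const_bound)
    show "AE \<omega> in M. norm (exp (\<theta> * (\<Sum>v\<in>S. g v \<omega> * d (l v) \<omega>))) \<le> exp (\<bar>\<theta>\<bar> * (\<Sum>v\<in>S. c v * u))"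
      using bounded[OF that] by simp
    have "(\<lambda>\<omega>. \<Sum>v\<in>S. g v \<omega> * d (l v) \<omega>) \<in> borel_measurable M"
      using measurable_from_subalg[OF subalgebra_past_algebra past_sum[of S "N + 1"]] that assms(3)
      by force
    then show "(\<lambda>\<omega>. exp (\<theta> * (\<Sum>v\<in>S. g v \<omega> * d (l v) \<omega>))) \<in> borel_measurable M"
      by measurable
  qed
  then show "integrable M (\<lambda>\<omega>. exp (\<theta> * (\<Sum>v\<in>V. g v \<omega> * d (l v) \<omega>)))"
    by simp
  have "S \<subseteq> V \<longrightarrow> expectation (\<lambda>\<omega>. exp (\<theta> * (\<Sum>v\<in>S. g v \<omega> * d (l v) \<omega>)))
           \<le> exp (\<theta>\<^sup>2 * u\<^sup>2 * (\<Sum>v\<in>S. (c v)\<^sup>2) / 2)" if "finite S" for S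
    using that
  proof (induction S rule: finite_ranking_induct[where f = l])
    case empty
    show ?case
      by (simp add: prob_space)
  next
    case (insert v S)
    show ?case
    proof (intro impI)
      assume sub: "insert v S \<subseteq> V"
      consider "v \<in> S" | "v \<notin> S" by blast
      then show "expectation (\<lambda>\<omega>. exp (\<theta> * (\<Sum>v\<in>insert v S. g v \<omega> * d (l v) \<omega>)))
           \<le> exp (\<theta>\<^sup>2 * u\<^sup>2 * (\<Sum>v\<in>insert v S. (c v)\<^sup>2) / 2)"
      proof cases
        case 1
        then show ?thesis
          using insert sub by (simp add: insert_absorb)
      next
        case 2
        \<comment> \<open>The accumulated exponential \<open>X\<close> and the coefficient \<open>Z\<close> of the new roundoff in the chord bound.\<close>
        define X where "X = (\<lambda>\<omega>. exp (\<theta> * (\<Sum>v\<in>S. g v \<omega> * d (l v) \<omega>)))"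
        define G where "G = (\<lambda>\<omega>. \<theta> * g v \<omega> * u)"
        define Z where "Z = (\<lambda>\<omega>. X \<omega> * sinh (G \<omega>) / u)"
        define C where "C = exp ((\<theta> * c v * u)\<^sup>2 / 2)"
        have kN: "l v \<in> {1..N}"
          using sub assms(3) by auto
        have less: "l w < l v" if "w \<in> S" for w
          using insert.hyps(2)[OF that] inj_onD[OF assms(2), of w v] sub that 2
          by (metis insert_subset le_neq_implies_less subsetD)
        have X [measurable]: "X \<in> borel_measurable (past_algebra M d (l v))"
          unfolding X_def using sub less
          by (intro borel_measurable_exp[THEN measurable_compose[rotated]] borel_measurable_times
              borel_measurable_const past_sum) auto
        have [measurable]: "g v \<in> borel_measurable (past_algebra M d (l v))"
          using assms(4) sub by auto
        have Z [measurable]: "Z \<in> borel_measurable (past_algebra M d (l v))"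
          unfolding Z_def G_def sinh_field_def by measurable
        have G: "(G \<omega>)\<^sup>2 \<le> (\<theta> * c v * u)\<^sup>2" for \<omega>
          using assms(5)[of v \<omega>] sub u_pos unfolding G_def
          by (intro abs_le_square_iff[THEN iffD1]) (auto simp: abs_mult intro!: mult_mono)
        have cosh_le: "cosh (G \<omega>) \<le> C" for \<omega>
          using cosh_le_exp_half_square[of "G \<omega>"] G[of \<omega>] unfolding C_def
          by (smt (verit) divide_right_mono exp_le_cancel_iff)
        have sinh_le: "\<bar>sinh (G \<omega>)\<bar> \<le> C" for \<omega>
          using cosh_le[of \<omega>] sinh_le_cosh_real[of "\<bar>G \<omega>\<bar>"]
          by (smt (verit) cosh_real_abs sinh_real_abs)
        have "AE \<omega> in M. \<bar>Z \<omega>\<bar> \<le> exp (\<bar>\<theta>\<bar> * (\<Sum>v\<in>S. c v * u)) * C / u"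
          using bounded[OF order.trans[OF subset_insertI sub]]
        proof eventually_elim
          case (elim \<omega>)
          then show ?case
            using u_pos sinh_le[of \<omega>] unfolding Z_def X_def
            by (auto simp: abs_mult intro!: divide_right_mono mult_mono)
        qed
        note ZE = expectation_past_times_roundoff[OF kN Z this]
        have intX: "integrable M X"
          unfolding X_def using integrable[of S] sub by simp
        have "expectation (\<lambda>\<omega>. exp (\<theta> * (\<Sum>v\<in>insert v S. g v \<omega> * d (l v) \<omega>)))
                \<le> expectation (\<lambda>\<omega>. X \<omega> * C + Z \<omega> * d (l v) \<omega>)"
        proof (rule integral_mono_AE)
          show "integrable M (\<lambda>\<omega>. exp (\<theta> * (\<Sum>v\<in>insert v S. g v \<omega> * d (l v) \<omega>)))"
            using integrable[OF sub] .
          show "integrable M (\<lambda>\<omega>. X \<omega> * C + Z \<omega> * d (l v) \<omega>)"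
            using intX ZE(1) by auto
          show "AE \<omega> in M. exp (\<theta> * (\<Sum>v\<in>insert v S. g v \<omega> * d (l v) \<omega>)) \<le> X \<omega> * C + Z \<omega> * d (l v) \<omega>"
            using roundoff_bound[OF kN]
          proof eventually_elim
            case (elim \<omega>)
            have "exp (\<theta> * (\<Sum>v\<in>insert v S. g v \<omega> * d (l v) \<omega>))
                    = X \<omega> * exp (\<theta> * g v \<omega> * d (l v) \<omega>)"
              using 2 insert.hyps(1) by (simp add: X_def exp_add algebra_simps)
            also have "\<dots> \<le> X \<omega> * (cosh (G \<omega>) + sinh (G \<omega>) / u * d (l v) \<omega>)"
              unfolding G_def using exp_le_cosh_chord[OF elim u_pos]
              by (intro mult_left_mono) (auto simp: X_def)
            also have "\<dots> = X \<omega> * cosh (G \<omega>) + Z \<omega> * d (l v) \<omega>"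
              by (simp add: Z_def algebra_simps)
            also have "\<dots> \<le> X \<omega> * C + Z \<omega> * d (l v) \<omega>"
              using cosh_le[of \<omega>] by (simp add: X_def)
            finally show ?case .
          qed
        qed
        also have "\<dots> = expectation X * C"
          using intX ZE by simp
        also have "\<dots> \<le> exp (\<theta>\<^sup>2 * u\<^sup>2 * (\<Sum>v\<in>S. (c v)\<^sup>2) / 2) * C"
          using insert.IH sub unfolding X_def C_def by (intro mult_right_mono) auto
        also have "\<dots> = exp (\<theta>\<^sup>2 * u\<^sup>2 * (\<Sum>v\<in>insert v S. (c v)\<^sup>2) / 2)"
          using 2 insert.hyps(1)
          by (simp add: C_def power_mult_distrib field_simps flip: exp_add)
        finally show ?thesis .
      qed
    qed
  qed
  from this[OF assms(1)] show "expectation (\<lambda>\<omega>. exp (\<theta> * (\<Sum>v\<in>V. g v \<omega> * d (l v) \<omega>)))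
           \<le> exp (\<theta>\<^sup>2 * u\<^sup>2 * (\<Sum>v\<in>V. (c v)\<^sup>2) / 2)"
    by simp
qed

text \<open>
  Markov's inequality for the exponential moment, with the optimal parameter \<open>\<theta>\<close>.
\<close>
lemma weighted_roundoff_sum_upper_tail:
  fixes l :: "'b \<Rightarrow> nat"
  assumes V: "finite V" "inj_on l V" "l ` V \<subseteq> {1..N}"
    and g: "\<And>v. v \<in> V \<Longrightarrow> g v \<in> borel_measurable (past_algebra M d (l v))"
      "\<And>v \<omega>. v \<in> V \<Longrightarrow> \<bar>g v \<omega>\<bar> \<le> c v"
    and pos: "0 < (\<Sum>v\<in>V. (c v)\<^sup>2)" and "0 < \<kappa>"
  shows "prob {\<omega> \<in> space M. (\<Sum>v\<in>V. g v \<omega> * d (l v) \<omega>) \<ge> \<kappa> * u * sqrt (\<Sum>v\<in>V. (c v)\<^sup>2)}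
           \<le> exp (- \<kappa>\<^sup>2 / 2)"
proof -
  define s where "s = (\<Sum>v\<in>V. (c v)\<^sup>2)"
  define \<theta> where "\<theta> = \<kappa> / (u * sqrt s)"
  have s: "0 < sqrt s" "(sqrt s)\<^sup>2 = s"
    using pos by (auto simp: s_def)
  have \<theta>: "0 < \<theta>" "\<theta> * (\<kappa> * u * sqrt s) = \<kappa>\<^sup>2" "\<theta>\<^sup>2 * u\<^sup>2 * s = \<kappa>\<^sup>2"
    using s u_pos \<open>0 < \<kappa>\<close> by (auto simp: \<theta>_def power_divide power_mult_distrib power2_eq_square)
  have int: "integrable M (\<lambda>\<omega>. exp (\<theta> * (\<Sum>v\<in>V. g v \<omega> * d (l v) \<omega>)))"
    by (rule weighted_roundoff_sum_exp_moment(1)[OF V g])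
  have "prob {\<omega> \<in> space M. (\<Sum>v\<in>V. g v \<omega> * d (l v) \<omega>) \<ge> \<kappa> * u * sqrt s}
          = prob {\<omega> \<in> space M. exp (\<theta> * (\<Sum>v\<in>V. g v \<omega> * d (l v) \<omega>)) \<ge> exp (\<kappa>\<^sup>2)}"
    using mult_le_cancel_left_pos[OF \<theta>(1), of "\<kappa> * u * sqrt s"] by (simp add: \<theta>(2))
  also have "\<dots> \<le> expectation (\<lambda>\<omega>. exp (\<theta> * (\<Sum>v\<in>V. g v \<omega> * d (l v) \<omega>))) / exp (\<kappa>\<^sup>2)"
    by (rule integral_Markov_inequality_measure[OF int, of "{}"]) auto
  also have "\<dots> \<le> exp (\<theta>\<^sup>2 * u\<^sup>2 * s / 2) / exp (\<kappa>\<^sup>2)"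
    unfolding s_def using weighted_roundoff_sum_exp_moment(2)[OF V g]
    by (intro divide_right_mono) auto
  also have "\<dots> = exp (- \<kappa>\<^sup>2 / 2)"
    by (simp add: \<theta>(3) flip: exp_diff)
  finally show ?thesis
    by (simp add: s_def)
qed

text \<open>
  The strict inequality in the event covers the degenerate case in which all bounds \<open>c v\<close> are zero.
\<close>
lemma weighted_roundoff_sum_tail:
  fixes l :: "'b \<Rightarrow> nat"
  assumes V: "finite V" "inj_on l V" "l ` V \<subseteq> {1..N}"
    and g: "\<And>v. v \<in> V \<Longrightarrow> g v \<in> borel_measurable (past_algebra M d (l v))"
      "\<And>v \<omega>. v \<in> V \<Longrightarrow> \<bar>g v \<omega>\<bar> \<le> c v"
    and "0 < \<kappa>"
  shows "{\<omega> \<in> space M. \<bar>\<Sum>v\<in>V. g v \<omega> * d (l v) \<omega>\<bar> > \<kappa> * u * sqrt (\<Sum>v\<in>V. (c v)\<^sup>2)} \<in> events"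
    and "prob {\<omega> \<in> space M. \<bar>\<Sum>v\<in>V. g v \<omega> * d (l v) \<omega>\<bar> > \<kappa> * u * sqrt (\<Sum>v\<in>V. (c v)\<^sup>2)}
           \<le> 2 * exp (- \<kappa>\<^sup>2 / 2)"
proof -
  define S where "S = (\<lambda>\<omega>. \<Sum>v\<in>V. g v \<omega> * d (l v) \<omega>)"
  define b where "b = \<kappa> * u * sqrt (\<Sum>v\<in>V. (c v)\<^sup>2)"
  have [measurable]: "S \<in> borel_measurable M"
    unfolding S_def
  proof (intro borel_measurable_sum borel_measurable_times)
    fix v assume "v \<in> V"
    then have "l v \<in> {1..N}" "l v \<le> N + 1"
      using V(3) by auto
    then show "g v \<in> borel_measurable M" "d (l v) \<in> borel_measurable M"
      using measurable_from_subalg[OF subalgebra_past_algebra g(1)] \<open>v \<in> V\<close> roundoff_measurable by auto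
  qed
  have "{\<omega> \<in> space M. \<bar>S \<omega>\<bar> > b} \<in> events"
    by measurable
  then show "{\<omega> \<in> space M. \<bar>\<Sum>v\<in>V. g v \<omega> * d (l v) \<omega>\<bar> > \<kappa> * u * sqrt (\<Sum>v\<in>V. (c v)\<^sup>2)} \<in> events"
    by (simp add: S_def b_def)
  have "prob {\<omega> \<in> space M. \<bar>S \<omega>\<bar> > b} \<le> 2 * exp (- \<kappa>\<^sup>2 / 2)"
  proof (cases "(\<Sum>v\<in>V. (c v)\<^sup>2) = 0")
    case True
    then have "\<forall>v\<in>V. c v = 0"
      using V(1) by (simp add: sum_nonneg_eq_0_iff)
    then have "g v \<omega> = 0" if "v \<in> V" for v \<omega>
      using g(2)[OF that, of \<omega>] that by simp
    then have empty: "{\<omega> \<in> space M. \<bar>S \<omega>\<bar> > b} = {}"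
      by (simp add: S_def b_def True)
    show ?thesis
      unfolding empty by simp
  next
    case False
    then have pos: "0 < (\<Sum>v\<in>V. (c v)\<^sup>2)"
      by (simp add: sum_nonneg order_less_le)
    have "prob {\<omega> \<in> space M. \<bar>S \<omega>\<bar> > b}
            \<le> prob ({\<omega> \<in> space M. S \<omega> \<ge> b} \<union> {\<omega> \<in> space M. - S \<omega> \<ge> b})"
      by (intro finite_measure_mono) auto
    also have "\<dots> \<le> prob {\<omega> \<in> space M. S \<omega> \<ge> b} + prob {\<omega> \<in> space M. - S \<omega> \<ge> b}"
      by (rule measure_Un_le) measurable
    also have "prob {\<omega> \<in> space M. S \<omega> \<ge> b} \<le> exp (- \<kappa>\<^sup>2 / 2)"
      unfolding S_def b_def
      by (rule weighted_roundoff_sum_upper_tail[OF V g pos \<open>0 < \<kappa>\<close>])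
    also have "prob {\<omega> \<in> space M. - S \<omega> \<ge> b} \<le> exp (- \<kappa>\<^sup>2 / 2)"
      using weighted_roundoff_sum_upper_tail[of V l "\<lambda>v \<omega>. - g v \<omega>" c, OF V _ _ pos \<open>0 < \<kappa>\<close>] g
      by (simp add: S_def b_def sum_negf)
    finally show ?thesis
      by simp
  qed
  then show "prob {\<omega> \<in> space M. \<bar>\<Sum>v\<in>V. g v \<omega> * d (l v) \<omega>\<bar> > \<kappa> * u * sqrt (\<Sum>v\<in>V. (c v)\<^sup>2)}
           \<le> 2 * exp (- \<kappa>\<^sup>2 / 2)"
    by (simp add: S_def b_def)
qed

end

section \<open>Summation trees and their deterministic error caps\<close>

text \<open>
  The label of an addition is the index of the roundoff that it commits.
\<close>
datatype sumtree = Input real | Add nat sumtree sumtree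

primrec computed :: "(nat \<Rightarrow> real) \<Rightarrow> sumtree \<Rightarrow> real" where
  "computed e (Input r) = r"
| "computed e (Add i a b) = (computed e a + computed e b) * (1 + e i)"

abbreviation exact :: "sumtree \<Rightarrow> real" where
  "exact \<equiv> computed (\<lambda>_. 0)"

primrec additions :: "sumtree \<Rightarrow> sumtree set" where
  "additions (Input r) = {}"
| "additions (Add i a b) = insert (Add i a b) (additions a \<union> additions b)"

primrec below :: "sumtree \<Rightarrow> sumtree set" where
  "below (Input r) = {}"
| "below (Add i a b) = additions a \<union> additions b"

primrec label :: "sumtree \<Rightarrow> nat" where
  "label (Input r) = 0"
| "label (Add i a b) = i"

primrec add_height :: "sumtree \<Rightarrow> nat" where
  "add_height (Input r) = 0"
| "add_height (Add i a b) = Suc (max (add_height a) (add_height b))"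

text \<open>
  Every addition has its own roundoff, and it is generated after those of the operands.
\<close>
primrec well_numbered :: "sumtree \<Rightarrow> bool" where
  "well_numbered (Input r) \<longleftrightarrow> True"
| "well_numbered (Add i a b) \<longleftrightarrow> well_numbered a \<and> well_numbered b \<and>
     label ` additions a \<inter> label ` additions b = {} \<and>
     (\<forall>v\<in>additions a \<union> additions b. label v < i)"

primrec operand_sum :: "(nat \<Rightarrow> real) \<Rightarrow> sumtree \<Rightarrow> real" where
  "operand_sum e (Input r) = 0"
| "operand_sum e (Add i a b) = computed e a + computed e b"

text \<open>
  The structural form of the sum \<open>Q\<close> of all \<open>(\<bar>s\<^sub>w\<bar> + F\<^sub>w)\<^sup>2\<close>; the parameter \<open>\<mu>\<close> stands for \<open>\<lambda> u\<close>.
\<close>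
primrec energy :: "real \<Rightarrow> sumtree \<Rightarrow> real" where
  "energy \<mu> (Input r) = 0"
| "energy \<mu> (Add i a b) = energy \<mu> a + energy \<mu> b +
     (\<bar>exact (Add i a b)\<bar> + \<mu> * sqrt (energy \<mu> a + energy \<mu> b))\<^sup>2"

primrec error_cap :: "real \<Rightarrow> sumtree \<Rightarrow> real" where
  "error_cap \<mu> (Input r) = 0"
| "error_cap \<mu> (Add i a b) = \<mu> * sqrt (energy \<mu> a + energy \<mu> b)"

definition capped_sum :: "real \<Rightarrow> (nat \<Rightarrow> real) \<Rightarrow> sumtree \<Rightarrow> real" where
  "capped_sum \<mu> e v =
     (if \<bar>operand_sum e v - exact v\<bar> \<le> error_cap \<mu> v then operand_sum e v else 0)"

lemma finite_additions [simp]: "finite (additions T)"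
  by (induction T) auto

lemma below_subset_additions: "below v \<subseteq> additions v"
  by (cases v) auto

lemma additions_subtree:
  assumes "v \<in> additions T"
  shows "additions v \<subseteq> additions T" and "well_numbered T \<Longrightarrow> well_numbered v"
  using assms by (induction T) auto

lemma inj_on_label_additions:
  assumes "well_numbered T"
  shows "inj_on label (additions T)"
  using assms
proof (induction T)
  case (Add i a b)
  then have "inj_on label (additions a \<union> additions b)"
    by (auto simp: inj_on_Un)
  with Add.prems show ?case
    by auto
qed simp

lemma sum_below:
  assumes "well_numbered (Add i a b)"
  shows "sum f (additions a \<union> additions b) = sum f (additions a) + sum f (additions b)"
  using assms by (intro sum.union_disjoint) auto

lemma sum_additions:
  assumes "well_numbered (Add i a b)"
  shows "sum f (additions (Add i a b))
           = f (Add i a b) + (sum f (additions a) + sum f (additions b))"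
proof -
  have "label v < i" if "v \<in> additions a \<union> additions b" for v
    using assms that by auto
  then have "Add i a b \<notin> additions a \<union> additions b"
    by fastforce
  then show ?thesis
    using sum_below[OF assms, of f] by simp
qed

lemma energy_eq_sum:
  assumes "well_numbered T"
  shows "energy \<mu> T = (\<Sum>v\<in>additions T. (\<bar>exact v\<bar> + error_cap \<mu> v)\<^sup>2)"
  using assms
proof (induction T)
  case (Add i a b)
  then show ?case
    by (subst sum_additions) auto
qed simp

lemma error_cap_eq:
  assumes "well_numbered v"
  shows "error_cap \<mu> v = \<mu> * sqrt (\<Sum>w\<in>below v. (\<bar>exact w\<bar> + error_cap \<mu> w)\<^sup>2)"
proof (cases v)
  case (Add i a b)
  then show ?thesis
    using assms sum_below[of i a b "\<lambda>w. (\<bar>exact w\<bar> + error_cap \<mu> w)\<^sup>2"]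
    by (simp add: energy_eq_sum)
qed simp

lemma energy_nonneg: "0 \<le> energy \<mu> T"
  by (induction T) auto

lemma error_cap_nonneg:
  assumes "0 \<le> \<mu>"
  shows "0 \<le> error_cap \<mu> v"
  using assms by (cases v) (auto simp: energy_nonneg)

text \<open>
  The square of the cap of a vertex is \<open>\<mu>\<^sup>2\<close> times the energy of its two subtrees, so the
  energy contributed by a vertex is counted once per ancestor.  Counting level by level avoids
  speaking of ancestors: a new root adds the energies of both subtrees once more.
\<close>
lemma sum_error_cap_square_le:
  assumes "well_numbered T"
  shows "(\<Sum>v\<in>additions T. (error_cap \<mu> v)\<^sup>2) \<le> \<mu>\<^sup>2 * (real (add_height T) * energy \<mu> T)"
  using assms
proof (induction T)
  case (Add i a b)
  define Q where "Q = energy \<mu>"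
  define H where "H = max (add_height a) (add_height b)"
  have Q: "0 \<le> Q a" "0 \<le> Q b"
    by (simp_all add: Q_def energy_nonneg)
  have "(\<Sum>v\<in>additions (Add i a b). (error_cap \<mu> v)\<^sup>2)
          \<le> \<mu>\<^sup>2 * (Q a + Q b) + (\<mu>\<^sup>2 * (real (add_height a) * Q a) + \<mu>\<^sup>2 * (real (add_height b) * Q b))"
    using Add Q by (subst sum_additions) (auto simp: Q_def power_mult_distrib intro!: add_mono)
  also have "\<dots> = \<mu>\<^sup>2 * ((1 + real (add_height a)) * Q a + (1 + real (add_height b)) * Q b)"
    by (simp add: algebra_simps)
  also have "\<dots> \<le> \<mu>\<^sup>2 * (real (Suc H) * Q a + real (Suc H) * Q b)"
    using Q by (intro mult_left_mono add_mono mult_right_mono) (auto simp: H_def)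
  also have "\<dots> = \<mu>\<^sup>2 * (real (Suc H) * (Q a + Q b))"
    by (simp add: algebra_simps)
  also have "\<dots> \<le> \<mu>\<^sup>2 * (real (Suc H) * Q (Add i a b))"
    by (intro mult_left_mono) (auto simp: Q_def)
  finally show ?case
    by (simp add: Q_def H_def)
qed simp

text \<open>
  The energy is the squared norm of the sum of two vectors, exact values and caps, and the
  norm of the caps is a fraction of the norm of the sum; the triangle inequality is solved for it.
\<close>
lemma sqrt_energy_le:
  assumes "well_numbered T" and "0 \<le> \<mu>" and "add_height T \<le> h" and "\<mu> * sqrt (real h) < 1"
  shows "sqrt (energy \<mu> T)
           \<le> sqrt (\<Sum>v\<in>additions T. (exact v)\<^sup>2) / (1 - \<mu> * sqrt (real h))"
proof -
  have "sqrt (energy \<mu> T) = L2_set (\<lambda>v. \<bar>exact v\<bar> + error_cap \<mu> v) (additions T)"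
    using assms(1) by (simp add: energy_eq_sum L2_set_def)
  also have "\<dots> \<le> L2_set (\<lambda>v. \<bar>exact v\<bar>) (additions T) + L2_set (error_cap \<mu>) (additions T)"
    by (rule L2_set_triangle_ineq)
  also have "L2_set (error_cap \<mu>) (additions T) \<le> sqrt (\<mu>\<^sup>2 * (real (add_height T) * energy \<mu> T))"
    unfolding L2_set_def using sum_error_cap_square_le[OF assms(1)] by (rule real_sqrt_le_mono)
  also have "\<dots> \<le> sqrt (\<mu>\<^sup>2 * (real h * energy \<mu> T))"
    using assms(3) by (intro real_sqrt_le_mono mult_left_mono mult_right_mono) (auto simp: energy_nonneg)
  also have "\<dots> = \<mu> * sqrt (real h) * sqrt (energy \<mu> T)"
    using assms(2) by (simp add: real_sqrt_mult)
  finally show ?thesis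
    using assms(4) by (simp add: L2_set_def field_simps)
qed

lemma capped_sum_le:
  assumes "0 \<le> \<mu>"
  shows "\<bar>capped_sum \<mu> e v\<bar> \<le> \<bar>exact v\<bar> + error_cap \<mu> v"
  using error_cap_nonneg[OF assms, of v] by (auto simp: capped_sum_def)

text \<open>
  If the capped sums below every vertex respect its cap, no capping takes place: by induction the
  errors of the operands of \<open>v\<close> are the capped sums below \<open>v\<close>, hence within the cap, so
  that \<open>v\<close> is not capped either.
\<close>
lemma error_eq_capped_sums:
  assumes "well_numbered T"
    and "\<And>v. v \<in> additions T \<Longrightarrow>
           \<bar>\<Sum>w\<in>below v. capped_sum \<mu> e w * e (label w)\<bar> \<le> error_cap \<mu> v"
  shows "computed e T - exact T = (\<Sum>w\<in>additions T. capped_sum \<mu> e w * e (label w))"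
  using assms
proof (induction T)
  case (Add i a b)
  let ?f = "\<lambda>w. capped_sum \<mu> e w * e (label w)"
  have IH: "computed e a - exact a = sum ?f (additions a)"
    "computed e b - exact b = sum ?f (additions b)"
    using Add by auto
  then have err: "computed e a + computed e b - exact (Add i a b) = sum ?f (below (Add i a b))"
    using sum_below[OF Add.prems(1), of ?f] by simp
  \<comment> \<open>The hypothesis at the root itself says that the error of its operands is within the cap.\<close>
  then have "capped_sum \<mu> e (Add i a b) = computed e a + computed e b"
    using Add.prems(2)[of "Add i a b"] by (auto simp: capped_sum_def)
  then show ?case
    using IH sum_additions[OF Add.prems(1), of ?f] by (simp add: algebra_simps)
qed simp

section \<open>The probabilistic error bound for a summation tree\<close>

context mean_independent_roundoffs
begin

lemma computed_past_measurable:
  assumes "label ` additions T \<subseteq> {1..<k}"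
  shows "(\<lambda>\<omega>. computed (\<lambda>i. d i \<omega>) T) \<in> borel_measurable (past_algebra M d k)"
  using assms
proof (induction T)
  case (Add i a b)
  then have [measurable]: "(\<lambda>\<omega>. computed (\<lambda>i. d i \<omega>) a) \<in> borel_measurable (past_algebra M d k)"
    "(\<lambda>\<omega>. computed (\<lambda>i. d i \<omega>) b) \<in> borel_measurable (past_algebra M d k)"
    by auto
  have [measurable]: "d i \<in> borel_measurable (past_algebra M d k)"
    using Add.prems by (intro past_roundoff_measurable) auto
  show ?case
    by simp
qed simp

lemma capped_sum_past_measurable:
  assumes "well_numbered v" and "label ` additions v \<subseteq> {1..N}"
  shows "(\<lambda>\<omega>. capped_sum \<mu> (\<lambda>i. d i \<omega>) v) \<in> borel_measurable (past_algebra M d (label v))"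
proof (cases v)
  case (Input r)
  then show ?thesis
    by (simp add: capped_sum_def cong: if_cong)
next
  case (Add i a b)
  have [measurable]: "(\<lambda>\<omega>. computed (\<lambda>i. d i \<omega>) a) \<in> borel_measurable (past_algebra M d i)"
    "(\<lambda>\<omega>. computed (\<lambda>i. d i \<omega>) b) \<in> borel_measurable (past_algebra M d i)"
    using assms Add by (auto intro!: computed_past_measurable)
  define s C where "s = exact v" and "C = error_cap \<mu> v"
  have "(\<lambda>\<omega>. let y = computed (\<lambda>i. d i \<omega>) a + computed (\<lambda>i. d i \<omega>) b
               in if \<bar>y - s\<bar> \<le> C then y else 0) \<in> borel_measurable (past_algebra M d i)"
    unfolding Let_def by measurable
  then show ?thesis
    by (simp add: capped_sum_def s_def C_def Add Let_def cong: if_cong)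
qed

text \<open>
  The failure probability \<open>\<eta>\<close> is spent in equal parts \<open>\<eta> / m\<close> on the additions, each of which
  must respect its cap: \<open>\<kappa>\<close> is chosen such that \<open>2 exp (- \<kappa>\<^sup>2 / 2) = \<eta> / m\<close>.  The probability \<open>\<delta>\<close> is spent on the root.
\<close>
theorem summation_tree_error:
  assumes T: "well_numbered T" "label ` additions T \<subseteq> {1..N}"
    and m: "real (card (additions T)) \<le> m" "1 \<le> m"
    and "0 < \<eta>" and \<kappa>: "\<kappa> = sqrt (2 * ln (2 * m / \<eta>))"
    and h: "add_height T \<le> h" and small: "\<kappa> * sqrt (real h) * u < 1"
    and E: "(\<Sum>v\<in>additions T. (exact v)\<^sup>2) \<le> E"
    and \<delta>: "0 < \<delta>" "\<delta> < 1"
  shows "prob {\<omega> \<in> space M. \<bar>computed (\<lambda>i. d i \<omega>) T - exact T\<bar>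
             \<le> u / (1 - \<kappa> * sqrt (real h) * u) * sqrt E * sqrt (2 * ln (2 / \<delta>))}
           \<ge> 1 - (\<delta> + \<eta>)"
    (is "prob ?Good \<ge> _")
\<comment> \<open>For \<open>\<eta> \<ge> 1\<close> the claim is void; otherwise the logarithm defining \<open>\<kappa>\<close> is positive.\<close>
proof (cases "\<eta> < 1")
  case False
  then show ?thesis
    using \<delta> measure_nonneg[of M ?Good] by linarith
next
  case True
  define \<mu> where "\<mu> = \<kappa> * u"
  define g where "g = (\<lambda>v \<omega>. capped_sum \<mu> (\<lambda>i. d i \<omega>) v)"
  define c where "c = (\<lambda>v. \<bar>exact v\<bar> + error_cap \<mu> v)"
  define S where "S = (\<lambda>V \<omega>. \<Sum>v\<in>V. g v \<omega> * d (label v) \<omega>)"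
  define r where "r = sqrt (2 * ln (2 / \<delta>))"
  \<comment> \<open>The event that the capped sum over \<open>V\<close> deviates by more than \<open>t\<close> times its scale.\<close>
  define bad where "bad = (\<lambda>t V. {\<omega> \<in> space M. \<bar>S V \<omega>\<bar> > t * u * sqrt (\<Sum>v\<in>V. (c v)\<^sup>2)})"
  have ratio: "1 < 2 * m / \<eta>" "1 < 2 / \<delta>"
    using m True \<open>0 < \<eta>\<close> \<delta> by (auto simp: field_simps)
  from ratio[THEN ln_gt_zero] have pos: "0 < \<kappa>" "0 < r" "0 \<le> \<mu>"
    using u_pos unfolding \<kappa> r_def \<mu>_def by simp_all
  have denom: "\<mu> * sqrt (real h) < 1"
    using small by (simp add: \<mu>_def mult.commute mult.left_commute)
  have "\<kappa>\<^sup>2 / 2 = ln (2 * m / \<eta>)" "r\<^sup>2 / 2 = ln (2 / \<delta>)"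
    using ratio by (auto simp: \<kappa> r_def)
  then have tails: "2 * exp (- \<kappa>\<^sup>2 / 2) = \<eta> / m" "2 * exp (- r\<^sup>2 / 2) = \<delta>"
    using ratio m \<open>0 < \<eta>\<close> \<delta> by (auto simp: exp_minus)
  have bad: "bad t V \<in> events" "prob (bad t V) \<le> 2 * exp (- t\<^sup>2 / 2)"
    if V: "V \<subseteq> additions T" and "0 < t" for t V
  proof -
    have *: "finite V" "inj_on label V" "label ` V \<subseteq> {1..N}"
      using finite_subset[OF V] inj_on_subset[OF inj_on_label_additions[OF T(1)] V]
        order.trans[OF image_mono[OF V] T(2)] by simp_all
    have meas: "g v \<in> borel_measurable (past_algebra M d (label v))" if "v \<in> V" for v
    proof -
      have v: "v \<in> additions T"
        using V that by blast
      show ?thesis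
        unfolding g_def using additions_subtree[OF v] T
        by (intro capped_sum_past_measurable order.trans[OF image_mono T(2)]) simp_all
    qed
    have capped: "\<bar>g v \<omega>\<bar> \<le> c v" for v \<omega>
      unfolding g_def c_def by (rule capped_sum_le[OF pos(3)])
    show "bad t V \<in> events" "prob (bad t V) \<le> 2 * exp (- t\<^sup>2 / 2)"
      unfolding bad_def S_def
      by (rule weighted_roundoff_sum_tail[OF * meas capped \<open>0 < t\<close>]; assumption)+
  qed
  have below: "below v \<subseteq> additions T" if "v \<in> additions T" for v
    using additions_subtree(1)[OF that] below_subset_additions[of v] by blast
  define Bad where "Bad = bad r (additions T) \<union> (\<Union>v\<in>additions T. bad \<kappa> (below v))"
  have events: "bad r (additions T) \<in> events" "(\<Union>v\<in>additions T. bad \<kappa> (below v)) \<in> events"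
    using bad(1) pos below by auto
  have "prob Bad \<le> prob (bad r (additions T)) + prob (\<Union>v\<in>additions T. bad \<kappa> (below v))"
    unfolding Bad_def using events by (intro measure_Un_le)
  also have "prob (bad r (additions T)) \<le> \<delta>"
    using bad(2)[of "additions T" r] pos tails by simp
  also have "prob (\<Union>v\<in>additions T. bad \<kappa> (below v)) \<le> (\<Sum>v\<in>additions T. prob (bad \<kappa> (below v)))"
    using bad(1) pos below by (intro finite_measure_subadditive_finite) auto
  also have "\<dots> \<le> real (card (additions T)) * (\<eta> / m)"
    using bad(2)[OF below pos(1), unfolded tails] by (intro sum_bounded_above)
  also have "\<dots> \<le> m * (\<eta> / m)"
    using m \<open>0 < \<eta>\<close> by (intro mult_right_mono) auto
  also have "\<dots> = \<eta>"
    using m by simp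
  finally have "prob Bad \<le> \<delta> + \<eta>"
    by simp
  then have "1 - (\<delta> + \<eta>) \<le> prob (space M - Bad)"
    using events by (subst prob_compl) (auto simp: Bad_def)
  also have "\<dots> \<le> prob ?Good"
  proof (rule finite_measure_mono)
    have "label ` additions T \<subseteq> {1..<N + 1}"
      using T(2) by auto
    then have [measurable]: "(\<lambda>\<omega>. computed (\<lambda>i. d i \<omega>) T) \<in> borel_measurable M"
      using measurable_from_subalg[OF subalgebra_past_algebra computed_past_measurable] by blast
    show "?Good \<in> events"
      by measurable
    show "space M - Bad \<subseteq> ?Good"
    proof
      fix \<omega> assume \<omega>: "\<omega> \<in> space M - Bad"
      have "\<bar>S (below v) \<omega>\<bar> \<le> error_cap \<mu> v" if "v \<in> additions T" for v
      proof -
        have "error_cap \<mu> v = \<kappa> * u * sqrt (\<Sum>w\<in>below v. (c w)\<^sup>2)"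
          using error_cap_eq[OF additions_subtree(2)[OF that T(1)]] by (simp add: c_def \<mu>_def)
        then show ?thesis
          using \<omega> that by (auto simp: Bad_def bad_def not_less)
      qed
      then have "computed (\<lambda>i. d i \<omega>) T - exact T = S (additions T) \<omega>"
        unfolding S_def g_def by (intro error_eq_capped_sums[OF T(1)])
      \<comment> \<open>The energy is exactly the sum of the squared bounds in the tail estimate at the root.\<close>
      also have "\<bar>\<dots>\<bar> \<le> r * u * sqrt (energy \<mu> T)"
        using \<omega> by (auto simp: Bad_def bad_def not_less energy_eq_sum[OF T(1)] c_def)
      also have "\<dots> \<le> r * u * (sqrt (\<Sum>v\<in>additions T. (exact v)\<^sup>2) / (1 - \<mu> * sqrt (real h)))"
        using sqrt_energy_le[OF T(1) pos(3) h denom] pos u_pos by (intro mult_left_mono) auto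
      also have "\<dots> \<le> r * u * (sqrt E / (1 - \<mu> * sqrt (real h)))"
        using E denom pos u_pos by (intro mult_left_mono divide_right_mono) auto
      also have "\<dots> = u / (1 - \<kappa> * sqrt (real h) * u) * sqrt E * r"
        by (simp add: \<mu>_def mult.commute mult.left_commute)
      finally show "\<omega> \<in> ?Good"
        using \<omega> by (auto simp: r_def)
    qed
  qed
  finally show ?thesis .
qed

end

section \<open>The tree of shifted general summation\<close>

text \<open>
  A leaf of the inner call becomes the addition of \<open>- c\<close>.  The labels are the positions in
  the order in which the roundoffs are generated.  As for \<open>vertex_val\<close>, the conditional only serves
  termination.
\<close>
function tree_of ::
  "nat \<Rightarrow> (nat \<Rightarrow> vertex \<times> vertex) \<Rightarrow> (nat \<Rightarrow> real) \<Rightarrow> real \<Rightarrow> vertex \<Rightarrow> sumtree" where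
  "tree_of n ch x c (Leaf i) = Add i (Input (x i)) (Input (- c))"
| "tree_of n ch x c (Inner k) =
     (if stage (fst (ch k)) < stage (Inner k) \<and> stage (snd (ch k)) < stage (Inner k)
      then Add (n + k - 1) (tree_of n ch x c (fst (ch k))) (tree_of n ch x c (snd (ch k)))
      else Input 0)"
  by pat_completeness auto
termination
  by (relation "Wellfounded.measure (\<lambda>(n, ch, x, c, v). stage v)") auto

declare tree_of.simps(2) [simp del]

definition shifted_tree ::
  "nat \<Rightarrow> (nat \<Rightarrow> vertex \<times> vertex) \<Rightarrow> (nat \<Rightarrow> real) \<Rightarrow> real \<Rightarrow> sumtree" where
  "shifted_tree n ch x c = Add (2 * n) (tree_of n ch x c (Inner n)) (Input (real n * c))"

lemma computed_tree_of:
  "computed e (tree_of n ch x c v) = vertex_val ch (computed_y x c e) (\<lambda>j. e (n + j - 1)) v"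
  by (induction n ch x c v rule: tree_of.induct)
     (auto simp: tree_of.simps(2) vertex_val.simps(2) computed_y_def)

lemma exact_tree_of_Leaf: "exact (tree_of n ch x c (Leaf i)) = exact_y x c i"
  by (simp add: exact_y_def)

lemma exact_tree_of_Inner: "exact (tree_of n ch x c (Inner k)) = exact_t ch x c k"
proof -
  have "computed_y x c (\<lambda>_. 0) = exact_y x c"
    by (auto simp: computed_y_def exact_y_def)
  then show ?thesis
    by (simp add: computed_tree_of exact_t_def)
qed

lemma computed_shifted_tree: "computed e (shifted_tree n ch x c) = computed_s n ch x c e"
  by (simp add: shifted_tree_def computed_s_def computed_t_def computed_tree_of)

lemma exact_shifted_tree: "exact (shifted_tree n ch x c) = exact_s n ch x c"
  by (simp add: shifted_tree_def exact_s_def exact_tree_of_Inner)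

definition vertices_upto :: "nat \<Rightarrow> nat \<Rightarrow> vertex set" where
  "vertices_upto n k = Leaf ` {1..n} \<union> Inner ` {2..k}"

lemma vertices_upto_mono: "j \<le> k \<Longrightarrow> vertices_upto n j \<subseteq> vertices_upto n k"
  by (auto simp: vertices_upto_def)

lemma pool_subset_vertices: "pool n ch k \<subseteq> vertices_upto n k"
proof (induction k)
  case 0
  show ?case
    by (subst pool.simps) (auto simp: vertices_upto_def)
next
  case (Suc k)
  then show ?case
    by (subst pool.simps) (auto simp: vertices_upto_def)
qed

context
  fixes n :: nat and ch :: "nat \<Rightarrow> vertex \<times> vertex"
  assumes order: "summation_order n ch"
begin

lemma children_in_pool:
  assumes "k \<in> {2..n}"
  shows "fst (ch k) \<in> pool n ch (k - 1)" and "snd (ch k) \<in> pool n ch (k - 1)"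
    and "fst (ch k) \<noteq> snd (ch k)"
  using order assms by (auto simp: summation_order_def)

lemma children_earlier:
  assumes "k \<in> {2..n}"
  shows "fst (ch k) \<in> vertices_upto n (k - 1)" and "snd (ch k) \<in> vertices_upto n (k - 1)"
  using children_in_pool[OF assms] pool_subset_vertices by blast+

lemma stage_vertices_upto: "v \<in> vertices_upto n k \<Longrightarrow> stage v \<le> Suc k"
  by (auto simp: vertices_upto_def)

lemma tree_of_Inner:
  assumes "k \<in> {2..n}"
  shows "tree_of n ch x c (Inner k)
           = Add (n + k - 1) (tree_of n ch x c (fst (ch k))) (tree_of n ch x c (snd (ch k)))"
  using children_earlier[OF assms, THEN stage_vertices_upto] assms
  by (auto simp: tree_of.simps(2))

text \<open>
  Induction over the part of the tree below a vertex, tracking the bound \<open>k\<close> on the indices of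
  partial sums that may occur there.
\<close>
lemma vertices_upto_induct [consumes 2, case_names Leaf Inner]:
  assumes "v \<in> vertices_upto n k" and "k \<le> n"
    and "\<And>i k. i \<in> {1..n} \<Longrightarrow> P k (Leaf i)"
    and "\<And>j k. j \<in> {2..n} \<Longrightarrow> j \<le> k \<Longrightarrow> P (j - 1) (fst (ch j)) \<Longrightarrow> P (j - 1) (snd (ch j)) \<Longrightarrow> P k (Inner j)"
  shows "P k v"
  using assms(1,2)
proof (induction k arbitrary: v rule: less_induct)
  case (less k)
  show ?case
  proof (cases v)
    case (Leaf i)
    then show ?thesis
      using less.prems assms(3) by (auto simp: vertices_upto_def)
  next
    case (Inner j)
    then have j: "j \<in> {2..n}" "j \<le> k"
      using less.prems by (auto simp: vertices_upto_def)
    then show ?thesis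
      unfolding Inner using children_earlier[OF j(1)] less.IH[of "j - 1"]
      by (intro assms(4)) auto
  qed
qed

lemma additions_tree_of:
  assumes "v \<in> vertices_upto n k" and "k \<le> n"
  shows "additions (tree_of n ch x c v) \<subseteq> tree_of n ch x c ` vertices_upto n k"
  using assms
proof (induction rule: vertices_upto_induct)
  case (Leaf i k)
  then have "Leaf i \<in> vertices_upto n k"
    by (simp add: vertices_upto_def)
  moreover have "additions (tree_of n ch x c (Leaf i)) = {tree_of n ch x c (Leaf i)}"
    by simp
  ultimately show ?case
    by (simp only: insert_subset empty_subsetI imageI simp_thms)
next
  case (Inner j k)
  have "Inner j \<in> vertices_upto n k"
    using Inner.hyps by (simp add: vertices_upto_def)
  moreover have "vertices_upto n (j - 1) \<subseteq> vertices_upto n k"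
    using Inner.hyps by (intro vertices_upto_mono) simp
  moreover have "additions (tree_of n ch x c (Inner j)) = insert (tree_of n ch x c (Inner j))
      (additions (tree_of n ch x c (fst (ch j))) \<union> additions (tree_of n ch x c (snd (ch j))))"
    unfolding tree_of_Inner[OF Inner.hyps(1)] by (rule additions.simps)
  ultimately show ?case
    using Inner.IH by blast
qed

lemma label_tree_of: "v \<in> vertices_upto n k \<Longrightarrow> k \<le> n \<Longrightarrow> label (tree_of n ch x c v) \<in> {1..n + (k - 1)}"
  by (auto simp: vertices_upto_def tree_of_Inner)

lemma labels_tree_of:
  assumes "v \<in> vertices_upto n k" and "k \<le> n"
  shows "label ` additions (tree_of n ch x c v) \<subseteq> {1..n + (k - 1)}"
  using additions_tree_of[OF assms, of x c] label_tree_of[OF _ assms(2), of _ x c] by blast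

text \<open>
  Disjointness of the labels below different elements of the pool has to be carried along: it makes
  the two operands of the next addition disjoint, and it is preserved because both leave the pool.
\<close>
lemma well_numbered_pool:
  assumes "1 \<le> k" and "k \<le> n"
  shows "(\<forall>v\<in>pool n ch k. well_numbered (tree_of n ch x c v)) \<and>
     disjoint_family_on (\<lambda>v. label ` additions (tree_of n ch x c v)) (pool n ch k)"
  using assms
proof (induction k rule: dec_induct)
  case base
  show ?case
    by (subst (1 2) pool.simps) (auto simp: disjoint_family_on_def)
next
  case (step k)
  define L where "L = (\<lambda>v. label ` additions (tree_of n ch x c v))"
  define a b where "a = fst (ch (Suc k))" and "b = snd (ch (Suc k))"
  have k: "Suc k \<in> {2..n}"
    using step by auto
  have ab: "a \<in> pool n ch k" "b \<in> pool n ch k" "a \<noteq> b"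
    using children_in_pool[OF k] by (auto simp: a_def b_def)
  have pool: "pool n ch (Suc k) = insert (Inner (Suc k)) (pool n ch k - {a, b})"
    using k by (subst pool.simps) (auto simp: a_def b_def)
  have tree: "tree_of n ch x c (Inner (Suc k)) = Add (n + k) (tree_of n ch x c a) (tree_of n ch x c b)"
    using tree_of_Inner[OF k] by (simp add: a_def b_def)
  then have L: "L (Inner (Suc k)) = insert (n + k) (L a \<union> L b)"
    by (auto simp: L_def)
  have IH: "\<forall>v\<in>pool n ch k. well_numbered (tree_of n ch x c v)" "disjoint_family_on L (pool n ch k)"
    using step k by (auto simp: L_def)
  have bound: "L v \<subseteq> {..<n + k}" if "v \<in> pool n ch k" for v
  proof -
    have "v \<in> vertices_upto n k" "k \<le> n"
      using that pool_subset_vertices k by auto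
    then have "L v \<subseteq> {1..n + (k - 1)}"
      unfolding L_def by (rule labels_tree_of)
    also have "\<dots> \<subseteq> {..<n + k}"
      using step(1) by auto
    finally show ?thesis .
  qed
  have "well_numbered (tree_of n ch x c (Inner (Suc k)))"
  proof -
    have "L a \<inter> L b = {}"
      using IH(2) ab by (simp add: disjoint_family_on_def)
    moreover have "label w < n + k"
      if "w \<in> additions (tree_of n ch x c a) \<union> additions (tree_of n ch x c b)" for w
    proof -
      have "label w \<in> L a \<union> L b"
        using that by (auto simp: L_def)
      then show ?thesis
        using bound[OF ab(1)] bound[OF ab(2)] by blast
    qed
    ultimately show ?thesis
      using IH(1) ab by (simp add: tree L_def)
  qed
  moreover have "disjoint_family_on L (pool n ch (Suc k))"
    unfolding pool
  proof (rule disjoint_family_on_insert[THEN iffD2, OF _ conjI])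
    show "Inner (Suc k) \<notin> pool n ch k - {a, b}"
      using pool_subset_vertices[of n ch k] by (auto simp: vertices_upto_def)
    have "L (Inner (Suc k)) \<inter> L v = {}" if v: "v \<in> pool n ch k" "v \<noteq> a" "v \<noteq> b" for v
    proof -
      have "L a \<inter> L v = {}" "L b \<inter> L v = {}"
        using IH(2) ab v by (simp_all add: disjoint_family_on_def)
      then show ?thesis
        using bound[OF v(1)] by (auto simp: L)
    qed
    then show "L (Inner (Suc k)) \<inter> \<Union> (L ` (pool n ch k - {a, b})) = {}"
      by blast
    show "disjoint_family_on L (pool n ch k - {a, b})"
      using IH(2) by (rule disjoint_family_on_mono[rotated]) blast
  qed
  ultimately show ?case
    using IH(1) unfolding L_def by (simp add: pool)
qed

text \<open>
  Descending into the higher operand at each step reaches a leaf.  The number of vertices on this path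
  is the height of the tree, since the addition at the leaf counts as well.
\<close>
lemma exists_path_of_tree_height:
  assumes "v \<in> vertices_upto n k" and "k \<le> n"
  shows "\<exists>p. p \<noteq> [] \<and> hd p = v \<and> last p \<in> range Leaf \<and> successively (is_child ch) p \<and>
           length p = add_height (tree_of n ch x c v)"
  using assms
proof (induction rule: vertices_upto_induct)
  case (Leaf i k)
  show ?case
    by (intro exI[of _ "[Leaf i]"]) auto
next
  case (Inner j k)
  define w where "w = (if add_height (tree_of n ch x c (fst (ch j))) \<le> add_height (tree_of n ch x c (snd (ch j)))
     then snd (ch j) else fst (ch j))"
  have height: "add_height (tree_of n ch x c (Inner j)) = Suc (add_height (tree_of n ch x c w))"
    using Inner.hyps by (auto simp: tree_of_Inner w_def)
  have "is_child ch (Inner j) w"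
    by (auto simp: is_child_def w_def)
  moreover have "\<exists>p. p \<noteq> [] \<and> hd p = w \<and> last p \<in> range Leaf \<and> successively (is_child ch) p \<and>
      length p = add_height (tree_of n ch x c w)"
    using Inner.IH by (simp add: w_def)
  then obtain p where "p \<noteq> []" "hd p = w" "last p \<in> range Leaf" "successively (is_child ch) p"
    "length p = add_height (tree_of n ch x c w)"
    by blast
  ultimately show ?case
    using height by (intro exI[of _ "Inner j # p"]) (auto simp: successively_Cons)
qed

text \<open>
  Stages decrease along a path.  The bound makes the set of path lengths finite, so that its maximum
  is meaningful.
\<close>
lemma path_length_le:
  assumes "successively (is_child ch) p" and "p \<noteq> []" and "hd p \<in> vertices_upto n n"
  shows "length p \<le> Suc (stage (hd p))"
  using assms
proof (induction p rule: induct_list012)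
  case (3 v w p)
  then obtain k where k: "v = Inner k" "w = fst (ch k) \<or> w = snd (ch k)"
    by (auto simp: is_child_def)
  then have "k \<in> {2..n}"
    using 3 by (auto simp: vertices_upto_def)
  then have "w \<in> vertices_upto n (k - 1)" "k \<le> n" "1 < k"
    using k(2) children_earlier by auto
  then have "w \<in> vertices_upto n n" "stage w < stage v"
    using vertices_upto_mono[of "k - 1" n n, THEN subsetD] stage_vertices_upto[of w "k - 1"] k(1)
    by auto
  then show ?case
    using 3 by auto
qed auto

text \<open>
  One level is added by the shifts at the leaves.
\<close>
lemma height_tree_of_root:
  assumes "2 \<le> n"
  shows "add_height (tree_of n ch x c (Inner n)) \<le> tree_height n ch + 1"
proof -
  have root: "Inner n \<in> vertices_upto n n"
    using assms by (auto simp: vertices_upto_def)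
  let ?D = "{length p - 1 | p. root_leaf_path n ch p}"
  have "length p - 1 \<le> Suc n" if "root_leaf_path n ch p" for p
    using path_length_le[of p] root that by (auto simp: root_leaf_path_def)
  then have "?D \<subseteq> {..Suc n}"
    by blast
  then have fin: "finite ?D"
    using finite_subset by blast
  obtain p where p: "root_leaf_path n ch p" "length p = add_height (tree_of n ch x c (Inner n))"
    using exists_path_of_tree_height[OF root order.refl, of x c]
    unfolding root_leaf_path_def by blast
  have "length p - 1 \<le> tree_height n ch"
    unfolding tree_height_def using p(1) by (intro Max_ge[OF fin]) auto
  then show ?thesis
    using p(2) by simp
qed

lemma shifted_tree_props:
  assumes "2 \<le> n"
  shows "well_numbered (shifted_tree n ch x c)"
    and "label ` additions (shifted_tree n ch x c) \<subseteq> {1..2 * n}"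
    and "add_height (shifted_tree n ch x c) \<le> tree_height n ch + 2"
proof -
  have root: "Inner n \<in> vertices_upto n n"
    using assms by (auto simp: vertices_upto_def)
  have "Inner n \<in> pool n ch n"
    using assms by (subst pool.simps) auto
  then have "well_numbered (tree_of n ch x c (Inner n))"
    using well_numbered_pool[of n x c] assms by auto
  moreover have labels: "label ` additions (tree_of n ch x c (Inner n)) \<subseteq> {1..n + (n - 1)}"
    using labels_tree_of[OF root] by blast
  moreover have "label v < 2 * n" if "v \<in> additions (tree_of n ch x c (Inner n))" for v
    using subsetD[OF labels imageI[OF that]] assms by auto
  ultimately show "well_numbered (shifted_tree n ch x c)"
    by (simp add: shifted_tree_def)
  have "{1..n + (n - 1)} \<subseteq> {1..2 * n}"
    by auto
  with labels have "label ` additions (tree_of n ch x c (Inner n)) \<subseteq> {1..2 * n}"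
    by (rule order.trans)
  then show "label ` additions (shifted_tree n ch x c) \<subseteq> {1..2 * n}"
    using assms by (simp add: shifted_tree_def)
  show "add_height (shifted_tree n ch x c) \<le> tree_height n ch + 2"
    using height_tree_of_root[OF assms, of x c] by (simp add: shifted_tree_def)
qed

lemma card_additions_shifted_tree:
  assumes "2 \<le> n"
  shows "card (additions (shifted_tree n ch x c)) \<le> 2 * n"
proof -
  have "card (additions (shifted_tree n ch x c)) = card (label ` additions (shifted_tree n ch x c))"
    by (rule card_image[symmetric, OF inj_on_label_additions[OF shifted_tree_props(1)[OF assms]]])
  also have "\<dots> \<le> card {1..2 * n}"
    by (rule card_mono[OF _ shifted_tree_props(2)[OF assms]]) simp
  finally show ?thesis
    by simp
qed

text \<open>
  Each addition is the tree of some vertex, and its exact value is the corresponding \<open>y\<^sub>k\<close> or \<open>t\<^sub>k\<close>, except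
  for the final addition, whose exact value is \<open>s\<^sub>n\<close>.
\<close>
lemma sum_exact_square_shifted_tree:
  assumes "2 \<le> n"
  shows "(\<Sum>v\<in>additions (shifted_tree n ch x c). (exact v)\<^sup>2)
           \<le> (exact_s n ch x c)\<^sup>2 + (\<Sum>k=2..n. (exact_t ch x c k)\<^sup>2) + (\<Sum>k=1..n. (exact_y x c k)\<^sup>2)"
proof -
  let ?tree = "tree_of n ch x c"
  have root: "Inner n \<in> vertices_upto n n"
    using assms by (auto simp: vertices_upto_def)
  have fin: "finite (vertices_upto n n)"
    by (auto simp: vertices_upto_def)
  have "(\<Sum>v\<in>additions (shifted_tree n ch x c). (exact v)\<^sup>2)
          = (exact_s n ch x c)\<^sup>2 + (\<Sum>v\<in>additions (?tree (Inner n)). (exact v)\<^sup>2)"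
    unfolding sum_additions[OF shifted_tree_props(1)[OF assms, unfolded shifted_tree_def],
        folded shifted_tree_def] exact_shifted_tree
    by simp
  also have "(\<Sum>v\<in>additions (?tree (Inner n)). (exact v)\<^sup>2) \<le> (\<Sum>v\<in>?tree ` vertices_upto n n. (exact v)\<^sup>2)"
    using additions_tree_of[OF root order.refl] fin by (intro sum_mono2) auto
  also have "\<dots> \<le> (\<Sum>v\<in>vertices_upto n n. (exact (?tree v))\<^sup>2)"
    using sum_image_le[OF fin, of "\<lambda>v. (exact v)\<^sup>2" ?tree] by (simp add: o_def)
  also have "\<dots> = (\<Sum>v\<in>Leaf ` {1..n}. (exact (?tree v))\<^sup>2) + (\<Sum>v\<in>Inner ` {2..n}. (exact (?tree v))\<^sup>2)"
    unfolding vertices_upto_def by (rule sum.union_disjoint) auto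
  also have "\<dots> = (\<Sum>k=1..n. (exact_y x c k)\<^sup>2) + (\<Sum>k=2..n. (exact_t ch x c k)\<^sup>2)"
    by (simp add: sum.reindex inj_on_def exact_tree_of_Leaf exact_tree_of_Inner del: tree_of.simps)
  finally show ?thesis
    by simp
qed

end

theorem theorem3p3:
  fixes M :: "'a measure" and d :: "nat \<Rightarrow> 'a \<Rightarrow> real"
    and n h :: nat and ch :: "nat \<Rightarrow> vertex \<times> vertex"
    and x :: "nat \<Rightarrow> real" and c u \<eta> \<delta> lam :: real
  assumes "prob_space M"
    and "n \<ge> 2"
    and "0 < u" and "u < 1"
    and "summation_order n ch"
    and "h = tree_height n ch"
    and "\<And>k. k \<in> {1..2 * n} \<Longrightarrow> d k \<in> borel_measurable M"
    and "\<And>k. k \<in> {1..2 * n} \<Longrightarrow> AE \<omega> in M. \<bar>d k \<omega>\<bar> \<le> u"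
    and "mean_independent_mean_zero M (2 * n) d"
    and "\<eta> > 0"
    and "lam = sqrt (2 * ln (2 * (2 * real n + 1) / \<eta>))"
    and "lam * sqrt (real h + 2) * u < 1"
    and "0 < \<delta>" and "\<delta> < 1"
  shows "measure M {\<omega> \<in> space M.
           \<bar>computed_s n ch x c (\<lambda>i. d i \<omega>) - exact_s n ch x c\<bar>
             \<le> u / (1 - lam * sqrt (real h + 2) * u)
                * sqrt ((exact_s n ch x c)\<^sup>2 + (\<Sum>k=2..n. (exact_t ch x c k)\<^sup>2)
                        + (\<Sum>k=1..n. (exact_y x c k)\<^sup>2))
                * sqrt (2 * ln (2 / \<delta>))}
         \<ge> 1 - (\<delta> + \<eta>)"
proof -
  interpret prob_space M
    by fact
  interpret mean_independent_roundoffs M "2 * n" d u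
    by unfold_locales (use assms in auto)
  note tree = shifted_tree_props[OF assms(5,2), of x c]
  have "real (card (additions (shifted_tree n ch x c))) \<le> 2 * real n + 1"
    using card_additions_shifted_tree[OF assms(5,2), of x c] by linarith
  note error = summation_tree_error[OF tree(1,2) this _ assms(10,11) tree(3) _
      sum_exact_square_shifted_tree[OF assms(5,2)] assms(13,14),
      unfolded exact_shifted_tree, unfolded computed_shifted_tree]
  have "real (tree_height n ch + 2) = real h + 2"
    using assms(6) by simp
  with error assms(12) show ?thesis
    by (simp add: add.commute)
qed

end
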